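(* Let $G$ be a finite group. Then every run of the minimal generating set algorithm described in the context (for any choice of the initial element $a_1\in G\setminus\{e\}$ and any admissible choices of the elements $b_i$ during the run) stops after finitely many steps, and the set $A$ at the time of stopping is a minimal generating set of $G$.
   Context: A generating set $A$ of a group $G$ is minimal if no proper subset of $A$ generates $G$. The (undirected) Cayley graph $\mathrm{Cay}(G,A)$, for an arbitrary subset $A$ of a group $G$ with identity $e$, is the graph with vertex set $G$ in which $\{u,v\}$ is an edge if and only if $u=va$ or $v=ua$ for some $a\in A\setminus\{e\}$. The component of a vertex $v$ is the subgraph induced by the set consisting of $v$ and all vertices joined to $v$ by a path. The minimal generating set algorithm for a finite group $G$ is: (1) Set $A:=\{a_1\}$, where $a_1\in G$ and $a_1\neq e$. (2) Set $v_1:=a_1$ and $i:=1$. (3) Form $\mathrm{Cay}(G,A)$. (4) If $\mathrm{Cay}(G,A)$ is connected, skip to step (7). Otherwise, set $i:=i+1$ and $v_2:=b_i$, where $b_i$ is an (arbitrarily chosen) element of $G$ not in the component of $v_1$ in $\mathrm{Cay}(G,A)$. (5) Set $a_i:=v_1^{-1}v_2$ and $A:=A\cup\{a_i\}$. (6) Return to step (3). (7) If $i=1$, stop. Otherwise, set $i:=i-1$. (8) Form $\mathrm{Cay}(G,A\setminus\{a_i\})$. (9) If $\mathrm{Cay}(G,A\setminus\{a_i\})$ is connected, set $A:=A\setminus\{a_i\}$. Otherwise, leave $A$ unchanged. (10) Return to step (7). *)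

theory Defs
  imports "HOL-Algebra.Generated_Groups" "Graph_Theory.Digraph_Component"
begin

definition generating_set :: "('a, 'b) monoid_scheme \<Rightarrow> 'a set \<Rightarrow> bool" where
  "generating_set G A \<longleftrightarrow> A \<subseteq> carrier G \<and> generate G A = carrier G"

definition minimal_generating_set :: "('a, 'b) monoid_scheme \<Rightarrow> 'a set \<Rightarrow> bool" where
  "minimal_generating_set G A \<longleftrightarrow>
     generating_set G A \<and> (\<forall>B. B \<subset> A \<longrightarrow> \<not> generating_set G B)"

text \<open>As usual in the graph library, an undirected graph is a symmetric digraph: the edge
  \<open>{u, v}\<close> is the pair of arcs \<open>(u, v)\<close> and \<open>(v, u)\<close>.\<close>

definition cayley_graph :: "('a, 'b) monoid_scheme \<Rightarrow> 'a set \<Rightarrow> 'a pair_pre_digraph" where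
  "cayley_graph G A =
     \<lparr> pverts = carrier G,
       parcs = {(u, v). u \<in> carrier G \<and> v \<in> carrier G \<and>
                  (\<exists>a \<in> A - {\<one>\<^bsub>G\<^esub>}. u = v \<otimes>\<^bsub>G\<^esub> a \<or> v = u \<otimes>\<^bsub>G\<^esub> a)} \<rparr>"

definition component :: "('a, 'e) pre_digraph \<Rightarrow> 'a \<Rightarrow> ('a, 'e) pre_digraph" where
  "component g v = induce_subgraph g (insert v {w. v \<rightarrow>\<^sup>*\<^bsub>g\<^esub> w})"

text \<open>The algorithm is a transition system. \<open>S\<^sub>k\<close> means that step (k) is executed next, and
  \<open>Halt\<close> that the algorithm has stopped. The variables \<open>A\<close>, \<open>v\<^sub>1\<close>, \<open>v\<^sub>2\<close>, \<open>i\<close> and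
  \<open>a\<^sub>1, a\<^sub>2, \<dots>\<close> are \<open>gen_set\<close>, \<open>vert1\<close>, \<open>vert2\<close>, \<open>index\<close> and \<open>elt 1, elt 2, \<dots>\<close>;
  \<open>cay\<close> is the Cayley graph most recently formed.\<close>

datatype location = S1 | S2 | S3 | S4 | S5 | S6 | S7 | S8 | S9 | S10 | Halt

record 'a mgs_state =
  location :: location
  gen_set :: "'a set"
  vert1 :: 'a
  vert2 :: 'a
  index :: nat
  elt :: "nat \<Rightarrow> 'a"
  cay :: "'a pair_pre_digraph"

inductive mgs_step ::
  "('a, 'b) monoid_scheme \<Rightarrow> 'a \<Rightarrow> 'a mgs_state \<Rightarrow> 'a mgs_state \<Rightarrow> bool"
  for G :: "('a, 'b) monoid_scheme" and a1 :: 'a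
where
  step1: "location s = S1 \<Longrightarrow>
    mgs_step G a1 s (s\<lparr>location := S2, elt := (elt s)(1 := a1), gen_set := {a1}\<rparr>)"
| step2: "location s = S2 \<Longrightarrow>
    mgs_step G a1 s (s\<lparr>location := S3, vert1 := elt s 1, index := 1\<rparr>)"
| step3: "location s = S3 \<Longrightarrow>
    mgs_step G a1 s (s\<lparr>location := S4, cay := cayley_graph G (gen_set s)\<rparr>)"
| step4_connected: "location s = S4 \<Longrightarrow> Digraph_Component.connected (cay s) \<Longrightarrow>
    mgs_step G a1 s (s\<lparr>location := S7\<rparr>)"
| step4_disconnected: "location s = S4 \<Longrightarrow> \<not> Digraph_Component.connected (cay s) \<Longrightarrow>
    b \<in> carrier G \<Longrightarrow> b \<notin> verts (component (cay s) (vert1 s)) \<Longrightarrow>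
    mgs_step G a1 s (s\<lparr>location := S5, index := index s + 1, vert2 := b\<rparr>)"
| step5: "location s = S5 \<Longrightarrow> c = inv\<^bsub>G\<^esub> (vert1 s) \<otimes>\<^bsub>G\<^esub> vert2 s \<Longrightarrow>
    mgs_step G a1 s
      (s\<lparr>location := S6, elt := (elt s)(index s := c), gen_set := gen_set s \<union> {c}\<rparr>)"
| step6: "location s = S6 \<Longrightarrow>
    mgs_step G a1 s (s\<lparr>location := S3\<rparr>)"
| step7_stop: "location s = S7 \<Longrightarrow> index s = 1 \<Longrightarrow>
    mgs_step G a1 s (s\<lparr>location := Halt\<rparr>)"
| step7_continue: "location s = S7 \<Longrightarrow> index s \<noteq> 1 \<Longrightarrow>
    mgs_step G a1 s (s\<lparr>location := S8, index := index s - 1\<rparr>)"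
| step8: "location s = S8 \<Longrightarrow>
    mgs_step G a1 s (s\<lparr>location := S9, cay := cayley_graph G (gen_set s - {elt s (index s)})\<rparr>)"
| step9_connected: "location s = S9 \<Longrightarrow> Digraph_Component.connected (cay s) \<Longrightarrow>
    mgs_step G a1 s (s\<lparr>location := S10, gen_set := gen_set s - {elt s (index s)}\<rparr>)"
| step9_disconnected: "location s = S9 \<Longrightarrow> \<not> Digraph_Component.connected (cay s) \<Longrightarrow>
    mgs_step G a1 s (s\<lparr>location := S10\<rparr>)"
| step10: "location s = S10 \<Longrightarrow>
    mgs_step G a1 s (s\<lparr>location := S7\<rparr>)"

text \<open>Before step (1) the variables have arbitrary values.\<close>

definition mgs_start :: "'a mgs_state \<Rightarrow> bool" where
  "mgs_start s \<longleftrightarrow> location s = S1"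

definition infinite_run ::
  "('a, 'b) monoid_scheme \<Rightarrow> 'a \<Rightarrow> (nat \<Rightarrow> 'a mgs_state) \<Rightarrow> bool" where
  "infinite_run G a1 r \<longleftrightarrow> mgs_start (r 0) \<and> (\<forall>n. mgs_step G a1 (r n) (r (Suc n)))"

text \<open>A finite run that cannot be continued, whether by reaching \<open>Halt\<close> or by getting stuck.\<close>

definition complete_run_to ::
  "('a, 'b) monoid_scheme \<Rightarrow> 'a \<Rightarrow> 'a mgs_state \<Rightarrow> bool" where
  "complete_run_to G a1 s \<longleftrightarrow>
     (\<exists>s0. mgs_start s0 \<and> (mgs_step G a1)\<^sup>*\<^sup>* s0 s) \<and> (\<nexists>s'. mgs_step G a1 s s')"

end

(*
  The component of v in Cay(G, A) is the coset v<A>, so Cay(G, A) is connected iff A generates G.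
  In the growing loop v1 = a_1 lies in <A>, so b_i lies outside <A> and hence so does
  a_i = v1^-1 b_i.  Thus <A> strictly increases, which can happen only finitely often.
  In the pruning loop an element found necessary stays necessary when A shrinks.  The last element
  a_n is never tested, but it is necessary because it lies outside <a_1, ..., a_(n-1)>.
*)

theory Submission
  imports Defs
begin

section \<open>Connectedness of Cayley graphs\<close>

lemma cayley_graph_simps [simp]:
  "pverts (cayley_graph G A) = carrier G"
  "(u, v) \<in> parcs (cayley_graph G A) \<longleftrightarrow> u \<in> carrier G \<and> v \<in> carrier G \<and>
     (\<exists>a \<in> A - {\<one>\<^bsub>G\<^esub>}. u = v \<otimes>\<^bsub>G\<^esub> a \<or> v = u \<otimes>\<^bsub>G\<^esub> a)"
  by (auto simp: cayley_graph_def)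

lemma wf_digraph_cayley_graph: "wf_digraph (with_proj (cayley_graph G A))"
  by unfold_locales auto

lemma symmetric_cayley_graph: "symmetric (with_proj (cayley_graph G A))"
  by (auto simp: symmetric_def intro!: symI)

text \<open>\<open>connected\<close> is defined through the symmetric closure, which adds no arcs
  here, and it demands a non-empty vertex set; hence the assumption.\<close>

lemma connected_cayley_graph_iff_reachable:
  assumes "carrier G \<noteq> {}"
  shows "Digraph_Component.connected (with_proj (cayley_graph G A)) \<longleftrightarrow>
    (\<forall>u \<in> carrier G. \<forall>v \<in> carrier G. u \<rightarrow>\<^sup>*\<^bsub>with_proj (cayley_graph G A)\<^esub> v)"
  using assms
  by (simp add: connected_def strongly_connected_def
      wf_digraph.reachable_mk_symmetric_eq[OF wf_digraph_cayley_graph symmetric_cayley_graph])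

context group
begin

text \<open>Induction on \<open>x\<close>: a generator or its inverse is a single arc or, if
  trivial, a path of length zero, and a product concatenates two paths. The second path starts at
  \<open>u \<otimes> x\<close>, so \<open>u\<close> must be arbitrary.\<close>

lemma reachable_cayley_graph_mult:
  assumes "A \<subseteq> carrier G" "x \<in> generate G A" "u \<in> carrier G"
  shows "u \<rightarrow>\<^sup>*\<^bsub>with_proj (cayley_graph G A)\<^esub> (u \<otimes> x)"
proof -
  interpret C: wf_digraph "with_proj (cayley_graph G A)"
    by (rule wf_digraph_cayley_graph)
  show ?thesis
    using assms(2,3)
  proof (induction arbitrary: u)
    case one
    then show ?case by simp
  next
    case (incl h)
    with assms(1) have h: "h \<in> carrier G" by blast
    show ?case
    proof (cases "h = \<one>")
      case False
      with incl h show ?thesis by (intro C.reachable_adjI) auto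
    qed (simp add: incl)
  next
    case (inv h)
    with assms(1) have h: "h \<in> carrier G" by blast
    show ?case
    proof (cases "h = \<one>")
      case False
      \<comment> \<open>Right multiplication by \<open>h\<close> leads from
        \<open>u \<otimes> inv h\<close> back to \<open>u\<close>; the arc from \<open>u\<close> is
        its reverse.\<close>
      moreover have "u = u \<otimes> inv h \<otimes> h"
        using inv.prems h by (simp add: m_assoc)
      ultimately show ?thesis using inv h by (intro C.reachable_adjI) auto
    qed (simp add: inv)
  next
    case (eng x y)
    then have "x \<in> carrier G" "y \<in> carrier G"
      using generate_in_carrier[OF assms(1)] by blast+
    with eng.prems have "u \<otimes> x \<in> carrier G" "u \<otimes> (x \<otimes> y) = u \<otimes> x \<otimes> y"
      by (simp_all add: m_assoc)
    then show ?case
      using C.reachable_trans[OF eng.IH(1)[OF eng.prems] eng.IH(2)] by simp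
  qed
qed

text \<open>Each arc multiplies on the right by a generator or its inverse, so a path never leaves
  the left coset of the generated subgroup; conversely, the whole coset is reached by the preceding
  lemma.\<close>

lemma reachable_cayley_graph_iff:
  assumes A: "A \<subseteq> carrier G" and u: "u \<in> carrier G" and w: "w \<in> carrier G"
  shows "u \<rightarrow>\<^sup>*\<^bsub>with_proj (cayley_graph G A)\<^esub> w \<longleftrightarrow> inv u \<otimes> w \<in> generate G A"
proof
  interpret C: wf_digraph "with_proj (cayley_graph G A)"
    by (rule wf_digraph_cayley_graph)
  assume "u \<rightarrow>\<^sup>*\<^bsub>with_proj (cayley_graph G A)\<^esub> w"
  then show "inv u \<otimes> w \<in> generate G A"
  proof (induction rule: C.reachable_induct)
    case base
    then show ?case using u by (simp add: generate.one)
  next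
    case (step x y)
    then obtain a where a: "a \<in> A" "x = y \<otimes> a \<or> y = x \<otimes> a"
      and xy: "x \<in> carrier G" "y \<in> carrier G" by auto
    from a(1) A have aG: "a \<in> carrier G" by blast
    have "y = x \<otimes> inv a \<or> y = x \<otimes> a"
      using a(2) xy aG by (auto simp: m_assoc)
    then obtain c where c: "c \<in> generate G A" "c \<in> carrier G" "y = x \<otimes> c"
      using generate.incl[OF a(1)] generate.inv[OF a(1)] aG by blast
    then have "inv u \<otimes> y = inv u \<otimes> x \<otimes> c"
      using u xy by (simp add: m_assoc)
    with generate.eng[OF step.IH c(1)] show ?case by simp
  qed
next
  assume "inv u \<otimes> w \<in> generate G A"
  from reachable_cayley_graph_mult[OF A this u]
  show "u \<rightarrow>\<^sup>*\<^bsub>with_proj (cayley_graph G A)\<^esub> w"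
    using u w by (simp add: m_assoc[symmetric])
qed

lemma connected_cayley_graph_iff:
  assumes A: "A \<subseteq> carrier G"
  shows "Digraph_Component.connected (with_proj (cayley_graph G A)) \<longleftrightarrow> generating_set G A"
proof -
  have "(\<forall>u \<in> carrier G. \<forall>v \<in> carrier G. inv u \<otimes> v \<in> generate G A) \<longleftrightarrow>
      generate G A = carrier G" (is "?L \<longleftrightarrow> ?R")
  proof
    assume ?L
    \<comment> \<open>The choice \<open>u = \<one>\<close> suffices.\<close>
    then have "\<forall>v \<in> carrier G. v \<in> generate G A"
      using inv_one l_one one_closed by metis
    then show ?R using generate_incl[OF A] by blast
  qed simp
  moreover have "carrier G \<noteq> {}" by blast
  ultimately show ?thesis
    using A by (simp add: connected_cayley_graph_iff_reachable reachable_cayley_graph_iff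
        generating_set_def)
qed

text \<open>The component of \<open>v\<close> is the left coset of \<open>v\<close>, which is the
  subgroup itself because \<open>v\<close> is one of the generators.\<close>

lemma verts_component_cayley_graph:
  assumes A: "A \<subseteq> carrier G" and v: "v \<in> A"
  shows "verts (component (with_proj (cayley_graph G A)) v) = generate G A"
proof -
  have vG: "v \<in> carrier G" using A v by blast
  have vgen: "v \<in> generate G A" using v by (rule generate.incl)
  have "v \<rightarrow>\<^sup>*\<^bsub>with_proj (cayley_graph G A)\<^esub> w \<longleftrightarrow> w \<in> generate G A" for w
  proof
    assume r: "v \<rightarrow>\<^sup>*\<^bsub>with_proj (cayley_graph G A)\<^esub> w"
    then have w: "w \<in> carrier G" by (auto elim: reachable_in_vertsE)
    with r have "inv v \<otimes> w \<in> generate G A"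
      using reachable_cayley_graph_iff[OF A vG] by blast
    with vgen have "v \<otimes> (inv v \<otimes> w) \<in> generate G A" by (rule generate.eng)
    then show "w \<in> generate G A" using vG w by (simp add: m_assoc[symmetric])
  next
    assume w: "w \<in> generate G A"
    with generate_m_inv_closed[OF A vgen] have "inv v \<otimes> w \<in> generate G A"
      by (rule generate.eng)
    then show "v \<rightarrow>\<^sup>*\<^bsub>with_proj (cayley_graph G A)\<^esub> w"
      using reachable_cayley_graph_iff[OF A vG] generate_in_carrier[OF A w] by blast
  qed
  then show ?thesis using vgen by (auto simp: component_def)
qed

end

section \<open>Invariant and termination of the algorithm\<close>

text \<open>The number \<open>n\<close> of elements chosen so far is a separate parameter because at
  \<open>S5\<close> the index is already one ahead. For \<open>j = 1\<close> the last condition says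
  that the first element is not the identity.\<close>

definition grown :: "('a, 'b) monoid_scheme \<Rightarrow> 'a mgs_state \<Rightarrow> nat \<Rightarrow> bool" where
  "grown G s n \<longleftrightarrow> 1 \<le> n \<and> vert1 s = elt s 1 \<and> gen_set s = elt s ` {1..n} \<and>
     gen_set s \<subseteq> carrier G \<and> (\<forall>j \<in> {1..n}. elt s j \<notin> generate G (elt s ` {1..<j}))"

text \<open>The elements with indices below \<open>i\<close> are those still to be tested; every
  other remaining element is known to be necessary.\<close>

definition pruned :: "('a, 'b) monoid_scheme \<Rightarrow> 'a mgs_state \<Rightarrow> nat \<Rightarrow> bool" where
  "pruned G s i \<longleftrightarrow> generating_set G (gen_set s) \<and>
     (\<forall>a \<in> gen_set s - elt s ` {1..<i}. \<not> generating_set G (gen_set s - {a}))"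

text \<open>The location is passed separately so that the equations can match on it. At
  \<open>S8\<close> and \<open>S9\<close> the index is already lowered but its element is not yet
  decided, hence \<open>Suc (index s)\<close>.\<close>

fun mgs_inv :: "('a, 'b) monoid_scheme \<Rightarrow> 'a \<Rightarrow> 'a mgs_state \<Rightarrow> location \<Rightarrow> bool" where
  "mgs_inv G a1 s S1 \<longleftrightarrow> True"
| "mgs_inv G a1 s S2 \<longleftrightarrow> elt s 1 = a1 \<and> gen_set s = {a1}"
| "mgs_inv G a1 s S3 \<longleftrightarrow> grown G s (index s)"
| "mgs_inv G a1 s S4 \<longleftrightarrow> grown G s (index s) \<and> cay s = cayley_graph G (gen_set s)"
| "mgs_inv G a1 s S5 \<longleftrightarrow> (\<exists>n. index s = Suc n \<and> grown G s n) \<and>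
     vert2 s \<in> carrier G - generate G (gen_set s)"
| "mgs_inv G a1 s S6 \<longleftrightarrow> grown G s (index s)"
| "mgs_inv G a1 s S7 \<longleftrightarrow> 1 \<le> index s \<and> pruned G s (index s)"
| "mgs_inv G a1 s S8 \<longleftrightarrow> 1 \<le> index s \<and> pruned G s (Suc (index s))"
| "mgs_inv G a1 s S9 \<longleftrightarrow> 1 \<le> index s \<and> pruned G s (Suc (index s)) \<and>
     cay s = cayley_graph G (gen_set s - {elt s (index s)})"
| "mgs_inv G a1 s S10 \<longleftrightarrow> 1 \<le> index s \<and> pruned G s (index s)"
| "mgs_inv G a1 s Halt \<longleftrightarrow> minimal_generating_set G (gen_set s)"

lemma grown_location_cay_update [simp]:
  "grown G (s\<lparr>location := l\<rparr>) n = grown G s n"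
  "grown G (s\<lparr>cay := g\<rparr>) n = grown G s n"
  "grown G (s\<lparr>index := i\<rparr>) n = grown G s n"
  "grown G (s\<lparr>vert2 := b\<rparr>) n = grown G s n"
  by (simp_all add: grown_def)

lemma grown_subset: "grown G s n \<Longrightarrow> gen_set s \<subseteq> carrier G"
  unfolding grown_def by blast

lemma vert1_in_gen_set: "grown G s n \<Longrightarrow> vert1 s \<in> gen_set s"
  by (auto simp: grown_def)

lemma pruned_location_cay_update [simp]:
  "pruned G (s\<lparr>location := l\<rparr>) n = pruned G s n"
  "pruned G (s\<lparr>cay := g\<rparr>) n = pruned G s n"
  "pruned G (s\<lparr>index := i\<rparr>) n = pruned G s n"
  by (simp_all add: pruned_def)

section \<open>Preservation of the invariant\<close>

context group
begin

lemma generating_set_mono: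
  assumes "generating_set G B" "B \<subseteq> A" "A \<subseteq> carrier G"
  shows "generating_set G A"
  using assms mono_generate[of B A] generate_incl[of A] by (auto simp: generating_set_def)

text \<open>Only the last element \<open>elt s n\<close> has to be necessary, and it lies outside
  the subgroup generated by its predecessors.\<close>

lemma pruned_if_grown:
  assumes s: "grown G s n" and gen: "generating_set G (gen_set s)"
  shows "pruned G s n"
proof -
  have "\<not> generating_set G (gen_set s - {a})" if a: "a \<in> gen_set s - elt s ` {1..<n}" for a
  proof
    assume *: "generating_set G (gen_set s - {a})"
    have n: "1 \<le> n" and img: "gen_set s = elt s ` {1..n}"
      and notin: "elt s n \<notin> generate G (elt s ` {1..<n})"
      using s unfolding grown_def by simp_all
    from n have "{1..n} = insert n {1..<n}" by auto
    with img have A: "gen_set s = insert (elt s n) (elt s ` {1..<n})"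
      by (simp only: image_insert)
    with grown_subset[OF s] have sub: "elt s n \<in> carrier G" "elt s ` {1..<n} \<subseteq> carrier G"
      by simp_all
    from a have "a = elt s n" unfolding A by (elim DiffE insertE) simp_all
    then have "gen_set s - {a} \<subseteq> elt s ` {1..<n}" unfolding A by simp
    then have "generating_set G (elt s ` {1..<n})"
      by (rule generating_set_mono[OF * _ sub(2)])
    with sub(1) notin show False by (simp add: generating_set_def)
  qed
  with gen show ?thesis by (simp add: pruned_def)
qed

text \<open>With \<open>{1..<1}\<close> empty, no single element can be removed. A proper subset
  omits some element, so by monotonicity it cannot generate either.\<close>

lemma minimal_generating_set_if_pruned:
  assumes "pruned G s 1"
  shows "minimal_generating_set G (gen_set s)"
proof -
  have "\<not> generating_set G B" if B: "B \<subset> gen_set s" for B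
  proof
    assume gen: "generating_set G B"
    from B obtain a where a: "a \<in> gen_set s" "B \<subseteq> gen_set s - {a}" by blast
    have "generating_set G (gen_set s - {a})"
      by (rule generating_set_mono[OF gen a(2)])
        (use assms in \<open>auto simp: pruned_def generating_set_def\<close>)
    with a(1) assms show False by (simp add: pruned_def)
  qed
  with assms show ?thesis by (simp add: minimal_generating_set_def pruned_def)
qed

lemma generating_set_remove_iff_connected:
  assumes "pruned G s n"
  shows "Digraph_Component.connected (with_proj (cayley_graph G (gen_set s - {a}))) \<longleftrightarrow>
    generating_set G (gen_set s - {a})"
  by (rule connected_cayley_graph_iff) (use assms in \<open>auto simp: pruned_def generating_set_def\<close>)

text \<open>If an element could be dropped from the smaller set, then by monotonicity it could be
  dropped from the larger one, so necessity survives the removal.\<close>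

lemma pruned_remove:
  assumes s: "pruned G s (Suc i)" and gen: "generating_set G (gen_set s - {elt s i})"
  shows "pruned G (s\<lparr>location := l, gen_set := gen_set s - {elt s i}\<rparr>) i"
proof -
  have "\<not> generating_set G (gen_set s - {elt s i} - {a})"
    if a: "a \<in> gen_set s - {elt s i} - elt s ` {1..<i}" for a
  proof
    assume *: "generating_set G (gen_set s - {elt s i} - {a})"
    have "generating_set G (gen_set s - {a})"
      by (rule generating_set_mono[OF *]) (use s in \<open>auto simp: pruned_def generating_set_def\<close>)
    \<comment> \<open>The additional index \<open>i\<close> does no harm: \<open>a\<close> differs
      from the removed \<open>elt s i\<close>.\<close>
    moreover have "a \<notin> elt s ` {1..<Suc i}"
      using a by (auto simp: less_Suc_eq)
    ultimately show False using s a by (auto simp: pruned_def)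
  qed
  with gen show ?thesis by (simp add: pruned_def)
qed

lemma pruned_keep:
  assumes s: "pruned G s (Suc i)" and gen: "\<not> generating_set G (gen_set s - {elt s i})"
  shows "pruned G s i"
proof -
  have "\<not> generating_set G (gen_set s - {a})" if a: "a \<in> gen_set s - elt s ` {1..<i}" for a
  proof (cases "a = elt s i")
    case False
    with a have "a \<in> gen_set s - elt s ` {1..<Suc i}" by (auto simp: less_Suc_eq)
    with s show ?thesis by (simp add: pruned_def)
  qed (use gen in simp)
  with s show ?thesis by (simp add: pruned_def)
qed

text \<open>Multiplying by \<open>v\<close> on the left, which stays in the subgroup, would bring
  \<open>b\<close> into it.\<close>

lemma new_element_notin_generate:
  assumes "A \<subseteq> carrier G" "v \<in> A" "b \<in> carrier G" "b \<notin> generate G A"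
  shows "inv v \<otimes> b \<notin> generate G A"
proof
  assume "inv v \<otimes> b \<in> generate G A"
  with generate.incl[OF assms(2)] have "v \<otimes> (inv v \<otimes> b) \<in> generate G A"
    by (rule generate.eng)
  with assms show False by (simp add: subset_iff m_assoc[symmetric])
qed

lemma grown_extend:
  assumes s: "grown G s n" and c: "c \<in> carrier G" "c \<notin> generate G (gen_set s)"
  shows "grown G (s\<lparr>location := l, elt := (elt s)(Suc n := c), gen_set := gen_set s \<union> {c}\<rparr>)
    (Suc n)"
proof -
  let ?e = "(elt s)(Suc n := c)"
  \<comment> \<open>The update at \<open>Suc n\<close> does not touch smaller indices, so the
    subgroups in the old independence conditions are unchanged.\<close>
  have img: "?e ` {1..<j} = elt s ` {1..<j}" if "j \<le> Suc n" for j
    using that by (intro image_cong) auto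
  have "{1..Suc n} = insert (Suc n) {1..<Suc n}" by auto
  then have "?e ` {1..Suc n} = insert c (?e ` {1..<Suc n})"
    by (simp only: image_insert fun_upd_same)
  also have "\<dots> = gen_set s \<union> {c}"
    unfolding img[OF order_refl]
    using s by (simp add: grown_def atLeastLessThanSuc_atLeastAtMost)
  finally have "?e ` {1..Suc n} = gen_set s \<union> {c}" .
  moreover have "?e j \<notin> generate G (?e ` {1..<j})" if "j \<in> {1..Suc n}" for j
  proof (cases "j = Suc n")
    case True
    with s c show ?thesis
      using img[of j] by (simp add: grown_def atLeastLessThanSuc_atLeastAtMost)
  next
    case False
    with s that img[of j] show ?thesis by (simp add: grown_def)
  qed
  ultimately show ?thesis using s c(1) by (auto simp: grown_def)
qed

lemma mgs_step_preserves_inv: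
  assumes a1: "a1 \<in> carrier G" "a1 \<noteq> \<one>"
    and step: "mgs_step G a1 s s'" and inv: "mgs_inv G a1 s (location s)"
  shows "mgs_inv G a1 s' (location s')"
  using step
proof cases
  case step1
  then show ?thesis by simp
next
  case step2
  \<comment> \<open>The empty set generates the trivial subgroup, which does not contain
    \<open>a1\<close> because \<open>a1 \<noteq> \<one>\<close>.\<close>
  with inv a1 show ?thesis by (simp add: grown_def generate_empty)
next
  case step3
  with inv show ?thesis by simp
next
  case step4_connected
  with inv have g: "grown G s (index s)" and "generating_set G (gen_set s)"
    using connected_cayley_graph_iff[OF grown_subset] by auto
  with step4_connected pruned_if_grown[OF this] show ?thesis by (simp add: grown_def)
next
  case (step4_disconnected b)
  with inv have g: "grown G s (index s)" "cay s = cayley_graph G (gen_set s)" by auto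
  then have "verts (component (cay s) (vert1 s)) = generate G (gen_set s)"
    using verts_component_cayley_graph[OF grown_subset vert1_in_gen_set] by simp
  with step4_disconnected g show ?thesis by simp
next
  case (step5 c)
  with inv obtain n where n: "index s = Suc n" "grown G s n"
    and v2: "vert2 s \<in> carrier G" "vert2 s \<notin> generate G (gen_set s)" by auto
  from n(2) have A: "gen_set s \<subseteq> carrier G" by (blast dest: grown_subset)
  note v1 = vert1_in_gen_set[OF n(2)]
  have "c \<in> carrier G" "c \<notin> generate G (gen_set s)"
    using step5(3) new_element_notin_generate[OF A v1 v2] A v1 v2 by auto
  from grown_extend[OF n(2) this] show ?thesis using step5 n by simp
next
  case step6
  with inv show ?thesis by simp
next
  case step7_stop
  with inv show ?thesis using minimal_generating_set_if_pruned by simp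
next
  case step7_continue
  \<comment> \<open>Here the index is at least 2, so the lowered index is still positive and its
    successor is the old index.\<close>
  with inv show ?thesis by auto
next
  case step8
  with inv show ?thesis by simp
next
  case step9_connected
  with inv show ?thesis
    using pruned_remove[of s "index s"] generating_set_remove_iff_connected[of s] by auto
next
  case step9_disconnected
  with inv show ?thesis
    using pruned_keep[of s "index s"] generating_set_remove_iff_connected[of s] by auto
next
  case step10
  with inv show ?thesis by simp
qed

end

section \<open>Termination measure and absence of deadlock\<close>

fun phase :: "location \<Rightarrow> nat" where
  "phase S1 = 3" | "phase S2 = 2" | "phase S3 = 1" | "phase S4 = 1" | "phase S5 = 1"
| "phase S6 = 1" | "phase S7 = 0" | "phase S8 = 0" | "phase S9 = 0" | "phase S10 = 0"
| "phase Halt = 0"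

text \<open>The index rises while the set grows, so it serves only for pruning; growth is measured
  by the elements not yet generated.\<close>

definition loop_variant :: "('a, 'b) monoid_scheme \<Rightarrow> 'a mgs_state \<Rightarrow> nat" where
  "loop_variant G s =
     (if phase (location s) = 0 then index s else card (carrier G - generate G (gen_set s)))"

text \<open>Each loop starts where its variant has just dropped: at S6 and at S8.\<close>

fun loop_position :: "location \<Rightarrow> nat" where
  "loop_position S6 = 4" | "loop_position S3 = 3" | "loop_position S4 = 2" | "loop_position S5 = 1"
| "loop_position S8 = 4" | "loop_position S9 = 3" | "loop_position S10 = 2" | "loop_position S7 = 1"
| "loop_position Halt = 0" | "loop_position S1 = 0" | "loop_position S2 = 0"

definition mgs_order :: "('a, 'b) monoid_scheme \<Rightarrow> 'a mgs_state rel" where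
  "mgs_order G =
     measures [\<lambda>s. phase (location s), loop_variant G, \<lambda>s. loop_position (location s)]"

context group
begin

lemma mgs_step_decreases:
  assumes fin: "finite (carrier G)"
    and step: "mgs_step G a1 s s'" and inv: "mgs_inv G a1 s (location s)"
  shows "(s', s) \<in> mgs_order G"
  using step
proof cases
  case (step5 c)
  with inv obtain n where n: "grown G s n"
    and v2: "vert2 s \<in> carrier G" "vert2 s \<notin> generate G (gen_set s)" by auto
  from n have A: "gen_set s \<subseteq> carrier G" by (blast dest: grown_subset)
  note v1 = vert1_in_gen_set[OF n]
  have c: "c \<in> carrier G" "c \<notin> generate G (gen_set s)"
    using step5(3) new_element_notin_generate[OF A v1 v2] A v1 v2 by auto
  \<comment> \<open>The element \<open>c\<close> witnesses that the subgroup grows strictly.\<close>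
  have "c \<in> generate G (gen_set s \<union> {c})" by (simp add: generate.incl)
  moreover have "generate G (gen_set s) \<subseteq> generate G (gen_set s \<union> {c})"
    by (rule mono_generate) blast
  ultimately have "carrier G - generate G (gen_set s \<union> {c}) \<subset> carrier G - generate G (gen_set s)"
    using c by blast
  then have "card (carrier G - generate G (gen_set s \<union> {c})) <
      card (carrier G - generate G (gen_set s))"
    using fin by (intro psubset_card_mono) auto
  then show ?thesis using step5 by (simp add: mgs_order_def loop_variant_def)
\<comment> \<open>At \<open>S7\<close> the invariant gives a positive index, so the truncated
  \<open>index s - 1\<close> is really smaller.\<close>
qed (use inv in \<open>auto simp: mgs_order_def loop_variant_def\<close>)

text \<open>The critical location is \<open>S4\<close>: a suitable \<open>b\<close> must exist when
  the graph is disconnected. It does, since the component of \<open>vert1 s\<close> is then a proper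
  subgroup.\<close>

lemma mgs_step_exists:
  assumes inv: "mgs_inv G a1 s (location s)" and "location s \<noteq> Halt"
  shows "\<exists>s'. mgs_step G a1 s s'"
proof (cases "location s")
  case S4
  with inv have g: "grown G s (index s)" "cay s = cayley_graph G (gen_set s)" by auto
  then have A: "gen_set s \<subseteq> carrier G" by (blast dest: grown_subset)
  show ?thesis
  proof (cases "Digraph_Component.connected (with_proj (cay s))")
    case True
    with S4 show ?thesis by (blast intro: mgs_step.step4_connected)
  next
    case False
    with g A have "generate G (gen_set s) \<noteq> carrier G"
      using connected_cayley_graph_iff[OF A] by (simp add: generating_set_def)
    then obtain b where "b \<in> carrier G" "b \<notin> generate G (gen_set s)"
      using generate_incl[OF A] by blast
    then show ?thesis
      using mgs_step.step4_disconnected[OF S4 False, of b G a1] g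
        verts_component_cayley_graph[OF A vert1_in_gen_set[OF g(1)]] by auto
  qed
next
  case S1
  show ?thesis by (rule exI, rule mgs_step.step1[OF S1])
next
  case S2
  show ?thesis by (rule exI, rule mgs_step.step2[OF S2])
next
  case S3
  show ?thesis by (rule exI, rule mgs_step.step3[OF S3])
next
  case S5
  show ?thesis by (rule exI, rule mgs_step.step5[OF S5 refl])
next
  case S6
  show ?thesis by (rule exI, rule mgs_step.step6[OF S6])
next
  case S8
  show ?thesis by (rule exI, rule mgs_step.step8[OF S8])
next
  case S10
  show ?thesis by (rule exI, rule mgs_step.step10[OF S10])
next
  case S7
  show ?thesis
  proof (cases "index s = 1")
    case True
    show ?thesis by (rule exI, rule mgs_step.step7_stop[OF S7 True])
  next
    case False
    show ?thesis by (rule exI, rule mgs_step.step7_continue[OF S7 False])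
  qed
next
  case S9
  show ?thesis
  proof (cases "Digraph_Component.connected (with_proj (cay s))")
    case True
    show ?thesis by (rule exI, rule mgs_step.step9_connected[OF S9 True])
  next
    case False
    show ?thesis by (rule exI, rule mgs_step.step9_disconnected[OF S9 False])
  qed
qed (use assms(2) in simp)

end

theorem mainTheorem3:
  fixes G :: "('a, 'b) monoid_scheme" and a1 :: 'a
  assumes "group G" and "finite (carrier G)"
    and "a1 \<in> carrier G" and "a1 \<noteq> \<one>\<^bsub>G\<^esub>"
  shows "(\<nexists>r. infinite_run G a1 r) \<and>
    (\<forall>s. complete_run_to G a1 s \<longrightarrow>
       location s = Halt \<and> minimal_generating_set G (gen_set s))"
proof (intro conjI allI impI notI)
  interpret group G by fact
  have start: "mgs_inv G a1 s (location s)" if "mgs_start s" for s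
    using that by (simp add: mgs_start_def)
  note preserve = mgs_step_preserves_inv[OF assms(3,4)]
  show False if "\<exists>r. infinite_run G a1 r"
  proof -
    from that obtain r where r: "mgs_start (r 0)" "\<And>n. mgs_step G a1 (r n) (r (Suc n))"
      by (auto simp: infinite_run_def)
    have "mgs_inv G a1 (r n) (location (r n))" for n
      by (induction n) (use r start preserve in blast)+
    then have "(r (Suc n), r n) \<in> mgs_order G" for n
      using mgs_step_decreases[OF assms(2) r(2)] by blast
    moreover have "wf (mgs_order G)" by (simp add: mgs_order_def)
    ultimately show False by (auto simp: wf_iff_no_infinite_down_chain)
  qed
  fix s
  assume "complete_run_to G a1 s"
  then obtain s0 where s0: "mgs_start s0" "(mgs_step G a1)\<^sup>*\<^sup>* s0 s"
    and stuck: "\<nexists>s'. mgs_step G a1 s s'" by (auto simp: complete_run_to_def)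
  from s0(2) have inv: "mgs_inv G a1 s (location s)"
    by induction (use start[OF s0(1)] preserve in blast)+
  \<comment> \<open>Under the invariant only \<open>Halt\<close> has no successor, and there the
    invariant is the required minimality.\<close>
  with stuck show halt: "location s = Halt" using mgs_step_exists by blast
  with inv show "minimal_generating_set G (gen_set s)" by simp
qed

end
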